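(* Let $\mathcal{A}=(Q,A,\delta)$ be a synchronizing deterministic finite automaton with a sink $s$ and $|A|>1$. Let $GC(\mathcal{A})=\{\mathcal{G}(\mathcal{M}(\mathcal{A},\chi)) : \chi \text{ is a group coloring of } \mathcal{A}\}$. Then every group in $GC(\mathcal{A})$ has finite order if and only if $\mathcal{A}$ is nilpotent.
   Context: A DFA is a triple $\mathcal{A}=(Q,A,\delta)$ with $Q$ a finite set of states, $A$ a finite alphabet, $\delta:Q\times A\to Q$; write $q\cdot a=\delta(q,a)$, extended to words and to subsets by $H\cdot u=\{q\cdot u:q\in H\}$. $\mathcal{A}$ is synchronizing if $|Q\cdot u|=1$ for some $u\in A^*$. A sink is a state $s$ with $s\cdot a=s$ for all $a\in A$. $\mathcal{A}$ is nilpotent if there are a state $s\in Q$ and an integer $n\ge1$ such that $Q\cdot w=\{s\}$ for every word $w\in A^*$ of length at least $n$. A group coloring $\chi$ of $\mathcal{A}$ assigns to each edge of the underlying digraph (one edge $q\to q\cdot a$ for each pair $(q,a)\in Q\times A$) a letter of $A$ so that, for each state $q$, the map from the outgoing edges of $q$ to $A$ is a bijection. The associated invertible Mealy automaton is $\mathcal{M}(\mathcal{A},\chi)=(Q,A,\delta,\lambda)$ where $\lambda(q,a)$ is the color of the edge given by $(q,a)$; so each $a\mapsto\lambda(q,a)$ is a permutation of $A$. For $q\in Q$ the transformation $\mathcal{M}_q:A^*\to A^*$ is defined by $\mathcal{M}_q(1)=1$ and $\mathcal{M}_q(a_0a_1\cdots a_n)=\lambda(q,a_0)\,\mathcal{M}_{q\cdot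 a_0}(a_1\cdots a_n)$; it is a bijection. $\mathcal{G}(\mathcal{M})$ is the group of bijections of $A^*$ generated by $\{\mathcal{M}_q:q\in Q\}$. *)

theory Defs
  imports "HOL-Algebra.Bij" "HOL-Algebra.Elementary_Groups"
begin

record ('q, 'a) automaton =
  states :: "'q set"
  alphabet :: "'a set"
  step :: "'q \<Rightarrow> 'a \<Rightarrow> 'q"

record ('q, 'a) mealy = "('q, 'a) automaton" +
  out :: "'q \<Rightarrow> 'a \<Rightarrow> 'a"

definition dfa :: "('q, 'a) automaton \<Rightarrow> bool" where
  "dfa \<A> \<longleftrightarrow> finite (states \<A>) \<and> finite (alphabet \<A>) \<and>
     (\<forall>q\<in>states \<A>. \<forall>a\<in>alphabet \<A>. step \<A> q a \<in> states \<A>)"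

definition run :: "('q, 'a) automaton \<Rightarrow> 'q \<Rightarrow> 'a list \<Rightarrow> 'q" where
  "run \<A> q u = foldl (step \<A>) q u"

definition set_run :: "('q, 'a) automaton \<Rightarrow> 'q set \<Rightarrow> 'a list \<Rightarrow> 'q set" where
  "set_run \<A> H u = (\<lambda>q. run \<A> q u) ` H"

definition synchronizing :: "('q, 'a) automaton \<Rightarrow> bool" where
  "synchronizing \<A> \<longleftrightarrow>
     (\<exists>u\<in>lists (alphabet \<A>). card (set_run \<A> (states \<A>) u) = 1)"

definition sink :: "('q, 'a) automaton \<Rightarrow> 'q \<Rightarrow> bool" where
  "sink \<A> s \<longleftrightarrow> s \<in> states \<A> \<and> (\<forall>a\<in>alphabet \<A>. step \<A> s a = s)"

definition nilpotent :: "('q, 'a) automaton \<Rightarrow> bool" where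
  "nilpotent \<A> \<longleftrightarrow> (\<exists>s\<in>states \<A>. \<exists>n\<ge>1. \<forall>w\<in>lists (alphabet \<A>).
     n \<le> length w \<longrightarrow> set_run \<A> (states \<A>) w = {s})"

text \<open>
  The underlying digraph may have parallel edges: its edges are the pairs \<open>(q, a)\<close>,
  where \<open>(q, a)\<close> leads from \<open>q\<close> to \<open>step \<A> q a\<close>. So the edges leaving \<open>q\<close> are
  \<open>{q} \<times> alphabet \<A>\<close>. Values of a coloring off the edge set are irrelevant.
\<close>

definition group_coloring :: "('q, 'a) automaton \<Rightarrow> ('q \<times> 'a \<Rightarrow> 'a) \<Rightarrow> bool" where
  "group_coloring \<A> \<chi> \<longleftrightarrow>
     (\<forall>q\<in>states \<A>. bij_betw \<chi> ({q} \<times> alphabet \<A>) (alphabet \<A>))"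

definition mealy_of :: "('q, 'a) automaton \<Rightarrow> ('q \<times> 'a \<Rightarrow> 'a) \<Rightarrow> ('q, 'a) mealy" where
  "mealy_of \<A> \<chi> = \<lparr>states = states \<A>, alphabet = alphabet \<A>, step = step \<A>,
     out = (\<lambda>q a. \<chi> (q, a))\<rparr>"

primrec mealy_map :: "('q, 'a) mealy \<Rightarrow> 'q \<Rightarrow> 'a list \<Rightarrow> 'a list" where
  "mealy_map M q [] = []"
| "mealy_map M q (a # w) = out M q a # mealy_map M (step M q a) w"

text \<open>
  Elements of \<^const>\<open>BijGroup\<close> are extensional functions, hence the restriction to words
  over the alphabet. As \<^const>\<open>subgroup_generated\<close> intersects the generators with the
  carrier, \<open>automaton_group_mealy_of\<close> below confirms that no generator is lost.
\<close>

definition automaton_group :: "('q, 'a) mealy \<Rightarrow> ('a list \<Rightarrow> 'a list) monoid" where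
  "automaton_group M = subgroup_generated (BijGroup (lists (alphabet M)))
     ((\<lambda>q. restrict (mealy_map M q) (lists (alphabet M))) ` states M)"

definition GC :: "('q, 'a) automaton \<Rightarrow> ('a list \<Rightarrow> 'a list) monoid set" where
  "GC \<A> = {automaton_group (mealy_of \<A> \<chi>) | \<chi>. group_coloring \<A> \<chi>}"

lemma mealy_of_simps [simp]:
  "states (mealy_of \<A> \<chi>) = states \<A>" "alphabet (mealy_of \<A> \<chi>) = alphabet \<A>"
  "step (mealy_of \<A> \<chi>) = step \<A>" "out (mealy_of \<A> \<chi>) q a = \<chi> (q, a)"
  by (simp_all add: mealy_of_def)

lemma group_coloring_bij:
  assumes "group_coloring \<A> \<chi>" "q \<in> states \<A>"
  shows "bij_betw (\<lambda>a. \<chi> (q, a)) (alphabet \<A>) (alphabet \<A>)"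
proof -
  have "bij_betw (Pair q) (alphabet \<A>) ({q} \<times> alphabet \<A>)"
    by (auto simp: bij_betw_def inj_on_def)
  moreover have "bij_betw \<chi> ({q} \<times> alphabet \<A>) (alphabet \<A>)"
    using assms by (simp add: group_coloring_def)
  ultimately show ?thesis
    using bij_betw_trans by (fastforce simp: comp_def)
qed

lemma mealy_map_bij:
  assumes "dfa \<A>" "group_coloring \<A> \<chi>" "q \<in> states \<A>"
  shows "bij_betw (mealy_map (mealy_of \<A> \<chi>) q) (lists (alphabet \<A>)) (lists (alphabet \<A>))"
proof -
  let ?M = "mealy_of \<A> \<chi>" and ?A = "alphabet \<A>"
  note cl = assms(1)[unfolded dfa_def]
  note bij = group_coloring_bij[OF assms(2)]
  have mem: "mealy_map ?M p w \<in> lists ?A" if "w \<in> lists ?A" "p \<in> states \<A>" for p w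
    using that
  proof (induction w arbitrary: p rule: list.induct)
    case (Cons a w)
    then show ?case using cl bij[OF Cons.prems(2)] by (auto dest: bij_betwE)
  qed simp
  have inj: "v = w" if "v \<in> lists ?A" "w \<in> lists ?A" "p \<in> states \<A>"
    "mealy_map ?M p v = mealy_map ?M p w" for p v w
    using that
  proof (induction v arbitrary: p w rule: list.induct)
    case Nil
    then show ?case by (cases w) auto
  next
    case (Cons a v)
    then obtain b u where w: "w = b # u" by (cases w) auto
    have "a = b"
      using Cons.prems bij[OF Cons.prems(3)] w by (auto simp: bij_betw_def dest: inj_onD)
    moreover have "v = u"
    proof (rule Cons.IH)
      show "step \<A> p a \<in> states \<A>" using Cons.prems cl by auto
      show "mealy_map ?M (step \<A> p a) v = mealy_map ?M (step \<A> p a) u"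
        using Cons.prems(4) w \<open>a = b\<close> by simp
    qed (use Cons.prems w in auto)
    ultimately show ?case using w by simp
  qed
  have surj: "\<exists>w\<in>lists ?A. mealy_map ?M p w = v" if "v \<in> lists ?A" "p \<in> states \<A>" for p v
    using that
  proof (induction v arbitrary: p rule: list.induct)
    case Nil
    then show ?case by (intro bexI[of _ "[]"]) auto
  next
    case (Cons b v)
    have "b \<in> (\<lambda>a. \<chi> (p, a)) ` ?A"
      using Cons.prems bij[OF Cons.prems(2)] by (auto simp: bij_betw_def)
    then obtain a where a: "a \<in> ?A" "\<chi> (p, a) = b" by auto
    then have "step \<A> p a \<in> states \<A>" using cl Cons.prems by auto
    then obtain w where "w \<in> lists ?A" "mealy_map ?M (step \<A> p a) w = v"
      using Cons by auto
    then show ?case using a by (intro bexI[of _ "a # w"]) auto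
  qed
  show ?thesis
    unfolding bij_betw_def
  proof
    show "inj_on (mealy_map ?M q) (lists ?A)"
      using inj assms(3) by (intro inj_onI) blast
    show "mealy_map ?M q ` lists ?A = lists ?A"
      using mem surj assms(3) by (fastforce simp: image_def)
  qed
qed

lemma automaton_group_mealy_of:
  assumes "dfa \<A>" "group_coloring \<A> \<chi>"
  shows "carrier (automaton_group (mealy_of \<A> \<chi>)) =
    generate (BijGroup (lists (alphabet \<A>)))
      ((\<lambda>q. restrict (mealy_map (mealy_of \<A> \<chi>) q) (lists (alphabet \<A>))) ` states \<A>)"
proof -
  have "(\<lambda>q. restrict (mealy_map (mealy_of \<A> \<chi>) q) (lists (alphabet \<A>))) ` states \<A>
      \<subseteq> carrier (BijGroup (lists (alphabet \<A>)))"
    using mealy_map_bij[OF assms] by (auto simp: BijGroup_def Bij_def cong: bij_betw_cong)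
  then show ?thesis
    by (simp add: automaton_group_def carrier_subgroup_generated Int_absorb1)
qed

end

theory Submission
  imports Defs "HOL-Algebra.Multiplicative_Group" "HOL-Combinatorics.Transposition"
begin

text \<open>
  If all words of length \<open>n\<close> lead to the sink \<open>s\<close>, then each generator changes the letters of a
  word after the first \<open>n\<close> by the single permutation \<open>out s\<close>; the permutations of words with this
  shape form a finite group. Otherwise some state \<open>q \<noteq> s\<close> lies on a cycle. Let \<open>p\<close> be the last
  state on a path from \<open>q\<close> to \<open>s\<close> that can still reach \<open>q\<close>: it has a letter \<open>a\<close> leading to a state
  that reaches \<open>p\<close> again and a letter \<open>b\<close> leading to a state that does not. Color \<open>p\<close> by the
  transposition of \<open>a\<close> and \<open>b\<close> and all other states by the identity. Then \<open>p\<close> acts like an odometer: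
  if its \<open>n\<close>-th power is trivial, then \<open>n\<close> is even and the \<open>n/2\<close>-th power is trivial, so \<open>n = 0\<close>.
\<close>

section \<open>Runs and cycles\<close>

definition reaches :: "('q, 'a) automaton \<Rightarrow> 'q \<Rightarrow> 'q \<Rightarrow> bool" where
  "reaches \<A> q r \<longleftrightarrow> (\<exists>w\<in>lists (alphabet \<A>). run \<A> q w = r)"

lemma run_simps [simp]:
  "run \<A> q [] = q"
  "run \<A> q (a # w) = run \<A> (step \<A> q a) w"
  "run \<A> q (u @ v) = run \<A> (run \<A> q u) v"
  by (simp_all add: run_def)

lemma run_states:
  assumes "dfa \<A>" "q \<in> states \<A>" "w \<in> lists (alphabet \<A>)"
  shows "run \<A> q w \<in> states \<A>"
  using assms(3,2)
  by (induction w arbitrary: q rule: list.induct) (use assms(1) in \<open>auto simp: dfa_def\<close>)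

lemma run_sink:
  assumes "sink \<A> s" "w \<in> lists (alphabet \<A>)"
  shows "run \<A> s w = s"
  using assms(2)
  by (induction w) (use assms(1) in \<open>auto simp: sink_def\<close>)

lemma reaches_refl [simp]: "reaches \<A> q q"
  unfolding reaches_def by (intro bexI[of _ "[]"]) auto

lemma reaches_trans:
  assumes "reaches \<A> p q" "reaches \<A> q r"
  shows "reaches \<A> p r"
proof -
  obtain u v where "u \<in> lists (alphabet \<A>)" "v \<in> lists (alphabet \<A>)"
    "run \<A> p u = q" "run \<A> q v = r"
    using assms unfolding reaches_def by blast
  then show ?thesis
    unfolding reaches_def by (intro bexI[of _ "u @ v"]) auto
qed

lemma reaches_step:
  assumes "a \<in> alphabet \<A>"
  shows "reaches \<A> q (step \<A> q a)"
  unfolding reaches_def using assms by (intro bexI[of _ "[a]"]) auto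

lemma reaches_stepE:
  assumes "reaches \<A> p q" "p \<noteq> q"
  obtains a where "a \<in> alphabet \<A>" "reaches \<A> (step \<A> p a) q"
proof -
  obtain w where "w \<in> lists (alphabet \<A>)" "run \<A> p w = q"
    using assms unfolding reaches_def by blast
  then show ?thesis
    using that assms(2) by (cases w) (auto simp: reaches_def)
qed

text \<open>A synchronizing word sends \<open>q\<close> and \<open>s\<close> to the same state, and
  no word moves the sink; so the common value is \<open>s\<close>.\<close>

lemma synchronizing_reaches_sink:
  assumes "synchronizing \<A>" "sink \<A> s" "q \<in> states \<A>"
  shows "reaches \<A> q s"
proof -
  obtain u where u: "u \<in> lists (alphabet \<A>)" "card (set_run \<A> (states \<A>) u) = 1"
    using assms(1) by (auto simp: synchronizing_def)
  obtain r where r: "set_run \<A> (states \<A>) u = {r}"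
    using u(2) by (auto simp: card_1_singleton_iff)
  have "run \<A> q u = r" "run \<A> s u = r"
    using r assms(2,3) by (auto simp: set_run_def sink_def)
  then show ?thesis
    using u(1) run_sink[OF assms(2) u(1)] by (auto simp: reaches_def)
qed

text \<open>The unnamed target state in \<open>nilpotent\<close> must be the given sink, because
  runs from \<open>s\<close> never leave \<open>s\<close>.\<close>

lemma nilpotent_sink:
  assumes "nilpotent \<A>" "sink \<A> s"
  obtains n where "\<And>q w. \<lbrakk>q \<in> states \<A>; w \<in> lists (alphabet \<A>); n \<le> length w\<rbrakk> \<Longrightarrow> run \<A> q w = s"
proof -
  obtain t n where t: "\<And>w. \<lbrakk>w \<in> lists (alphabet \<A>); n \<le> length w\<rbrakk> \<Longrightarrow>
      set_run \<A> (states \<A>) w = {t}"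
    using assms(1) unfolding nilpotent_def by blast
  have "run \<A> q w = s" if "q \<in> states \<A>" "w \<in> lists (alphabet \<A>)" "n \<le> length w" for q w
  proof -
    have "s \<in> states \<A>" using assms(2) by (simp add: sink_def)
    then have "run \<A> q w = t" "run \<A> s w = t"
      using t[OF that(2,3)] that(1) by (auto simp: set_run_def)
    then show ?thesis using run_sink[OF assms(2) that(2)] by simp
  qed
  then show ?thesis using that by blast
qed

text \<open>Pigeonhole on a run of length at least \<open>card (states \<A>)\<close> that ends off
  the sink. Since \<open>reaches\<close> is reflexive, the letter \<open>a\<close> is what makes the
  cycle nonempty.\<close>

lemma not_nilpotent_cycle:
  assumes "dfa \<A>" "sink \<A> s" "\<not> nilpotent \<A>"
  obtains q a where "q \<in> states \<A>" "q \<noteq> s" "a \<in> alphabet \<A>" "reaches \<A> (step \<A> q a) q"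
proof -
  have fin: "finite (states \<A>)" and s: "s \<in> states \<A>"
    using assms by (auto simp: dfa_def sink_def)
  let ?n = "card (states \<A>)"
  \<comment> \<open>\<open>nilpotent\<close> asks for a bound of at least 1, so \<open>?n\<close>
    must be positive before its failure can be instantiated there.\<close>
  have "1 \<le> ?n" using fin s by (metis One_nat_def Suc_leI card_gt_0_iff empty_iff)
  then obtain w where w: "w \<in> lists (alphabet \<A>)" "?n \<le> length w"
      "set_run \<A> (states \<A>) w \<noteq> {s}"
    using assms(3) s unfolding nilpotent_def by blast
  have "\<exists>q\<in>states \<A>. run \<A> q w \<noteq> s"
  proof (rule ccontr)
    assume "\<not> ?thesis"
    then have "set_run \<A> (states \<A>) w = (\<lambda>_. s) ` states \<A>"
      unfolding set_run_def by (intro image_cong) auto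
    then show False using w(3) s by auto
  qed
  then obtain q where q: "q \<in> states \<A>" "run \<A> q w \<noteq> s" by blast
  \<comment> \<open>The indices \<open>0..?n\<close> give \<open>?n + 1\<close> visited states, one
    more than there are states.\<close>
  define f where "f i = run \<A> q (take i w)" for i
  have "f ` {..?n} \<subseteq> states \<A>"
    using run_states[OF assms(1) q(1)] w(1) by (auto simp: f_def dest: in_set_takeD)
  then have "card (f ` {..?n}) \<le> ?n" using fin card_mono by blast
  then have "\<not> inj_on f {..?n}" by (auto dest: card_image)
  then obtain i j where ij: "i < j" "j \<le> ?n" "f i = f j"
    by (metis atMost_iff inj_onI linorder_neqE_nat)
  have len: "i < length w" using ij w(2) by simp
  have "f i \<noteq> s"
  proof
    assume "f i = s"
    moreover have "run \<A> q w = run \<A> (f i) (drop i w)"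
      unfolding f_def by (simp flip: run_simps(3))
    ultimately show False
      using run_sink[OF assms(2), of "drop i w"] w(1) q(2) by (auto dest: in_set_dropD)
  qed
  moreover have "f i \<in> states \<A>" using \<open>f ` {..?n} \<subseteq> states \<A>\<close> ij by auto
  moreover have "w ! i \<in> alphabet \<A>" using w(1) len by auto
  moreover have "reaches \<A> (step \<A> (f i) (w ! i)) (f i)"
  proof -
    \<comment> \<open>The segment of \<open>w\<close> strictly after position \<open>i\<close> and
      before position \<open>j\<close>: it closes the cycle once letter \<open>w ! i\<close> has
      been read.\<close>
    define v where "v = take (j - Suc i) (drop (Suc i) w)"
    have "take j w = take (Suc i) w @ v"
      unfolding v_def using ij(1) take_add[of "Suc i" "j - Suc i" w] by simp
    then have "f j = run \<A> (step \<A> (f i) (w ! i)) v"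
      using len by (simp add: f_def take_Suc_conv_app_nth)
    moreover have "v \<in> lists (alphabet \<A>)"
      using w(1) unfolding v_def by (auto dest: in_set_takeD in_set_dropD)
    ultimately show ?thesis using ij(3) unfolding reaches_def by metis
  qed
  ultimately show ?thesis using that by blast
qed

text \<open>Follow a word from \<open>q\<close> to \<open>t\<close> while the current state can
  still return to \<open>q\<close>. As \<open>t\<close> cannot, some letter loses this property, and
  a lost return is never regained.\<close>

lemma reaches_last_exit:
  assumes "reaches \<A> q t" "\<not> reaches \<A> t q"
  obtains p b where "reaches \<A> q p" "reaches \<A> p q" "b \<in> alphabet \<A>" "\<not> reaches \<A> (step \<A> p b) q"
proof -
  have "\<exists>p b. reaches \<A> q p \<and> reaches \<A> p q \<and> b \<in> alphabet \<A> \<and> \<not> reaches \<A> (step \<A> p b) q"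
    if "w \<in> lists (alphabet \<A>)" "reaches \<A> q r" "reaches \<A> r q" "run \<A> r w = t" for r w
    using that
  proof (induction w arbitrary: r rule: list.induct)
    case Nil
    then show ?case using assms(2) by auto
  next
    case (Cons b w)
    then have b: "b \<in> alphabet \<A>" and w: "w \<in> lists (alphabet \<A>)" by auto
    have "reaches \<A> q (step \<A> r b)"
      using reaches_trans Cons.prems(2) reaches_step[OF b] by metis
    then show ?case
      using Cons.IH[OF w, of "step \<A> r b"] Cons.prems b by (cases "reaches \<A> (step \<A> r b) q") auto
  qed
  moreover obtain w where "w \<in> lists (alphabet \<A>)" "run \<A> q w = t"
    using assms(1) by (auto simp: reaches_def)
  ultimately show ?thesis using that by (metis reaches_refl)
qed

lemma not_nilpotent_exit:
  assumes "dfa \<A>" "synchronizing \<A>" "sink \<A> s" "\<not> nilpotent \<A>"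
  obtains p a b where "p \<in> states \<A>" "a \<in> alphabet \<A>" "b \<in> alphabet \<A>"
    "reaches \<A> (step \<A> p a) p" "\<not> reaches \<A> (step \<A> p b) p"
proof -
  obtain q c where q: "q \<in> states \<A>" "q \<noteq> s" "c \<in> alphabet \<A>" "reaches \<A> (step \<A> q c) q"
    using not_nilpotent_cycle[OF assms(1,3,4)] .
  have "\<not> reaches \<A> s q" using q(2) run_sink[OF assms(3)] by (auto simp: reaches_def)
  then obtain p b where p: "reaches \<A> q p" "reaches \<A> p q" "b \<in> alphabet \<A>"
      "\<not> reaches \<A> (step \<A> p b) q"
    using reaches_last_exit[OF synchronizing_reaches_sink[OF assms(2,3) q(1)]] by blast
  obtain a where "a \<in> alphabet \<A>" "reaches \<A> (step \<A> p a) p"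
  \<comment> \<open>For \<open>p = q\<close> the path from \<open>p\<close> to \<open>q\<close> may
    be empty, so the letter \<open>c\<close> of the cycle is taken. Otherwise the first letter of a
    path to \<open>q\<close> serves, and \<open>q\<close> leads back to \<open>p\<close>.\<close>
  proof (cases "p = q")
    case True
    then show ?thesis using that q(3,4) by blast
  next
    case False
    then show ?thesis using that reaches_stepE[OF p(2)] reaches_trans p(1) by metis
  qed
  moreover have "p \<in> states \<A>"
    using p(1) run_states[OF assms(1) q(1)] by (auto simp: reaches_def)
  \<comment> \<open>A return to \<open>p\<close> would continue to \<open>q\<close>.\<close>
  moreover have "\<not> reaches \<A> (step \<A> p b) p" using p reaches_trans by metis
  ultimately show ?thesis using that p(3) by blast
qed

section \<open>Nilpotent automata\<close>

lemma mealy_map_append: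
  "mealy_map M q (u @ v) = mealy_map M q u @ mealy_map M (foldl (step M) q u) v"
  by (induction u arbitrary: q) auto

lemma length_mealy_map [simp]: "length (mealy_map M q w) = length w"
  by (induction w arbitrary: q) auto

lemma mealy_map_sink:
  assumes "\<And>a. a \<in> A \<Longrightarrow> step M s a = s" "w \<in> lists A"
  shows "mealy_map M s w = map (out M s) w"
  using assms(2) by (induction w) (use assms(1) in auto)

text \<open>The condition constrains only words longer than \<open>n\<close>, since
  \<open>take n w = w\<close> otherwise. Preservation of length is included so that cutting a word
  at position \<open>n\<close> commutes with \<open>g\<close>.\<close>

definition eventually_letterwise :: "'a set \<Rightarrow> nat \<Rightarrow> ('a list \<Rightarrow> 'a list) set" where
  "eventually_letterwise A n = {g \<in> Bij (lists A). (\<forall>w\<in>lists A. length (g w) = length w) \<and>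
     (\<exists>\<tau>\<in>Bij A. \<forall>w\<in>lists A. g w = g (take n w) @ map \<tau> (drop n w))}"

lemma BijGroup_simps:
  "carrier (BijGroup S) = Bij S"
  "\<one>\<^bsub>BijGroup S\<^esub> = (\<lambda>x\<in>S. x)"
  "\<lbrakk>f \<in> Bij S; g \<in> Bij S\<rbrakk> \<Longrightarrow> f \<otimes>\<^bsub>BijGroup S\<^esub> g = compose S f g"
  by (simp_all add: BijGroup_def)

lemma take_in_lists: "w \<in> lists A \<Longrightarrow> take n w \<in> lists A"
  by (auto dest: in_set_takeD)

lemma drop_in_lists: "w \<in> lists A \<Longrightarrow> drop n w \<in> lists A"
  by (auto dest: in_set_dropD)

text \<open>An element is determined by its values on words of length at most \<open>n\<close> and
  by \<open>\<tau>\<close>; both range over finite sets, and \<open>?\<Phi>\<close> reassembles the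
  element.\<close>

lemma finite_eventually_letterwise:
  assumes "finite A"
  shows "finite (eventually_letterwise A n)"
proof -
  let ?W = "{w \<in> lists A. length w \<le> n}"
  let ?\<Phi> = "\<lambda>(f, \<tau>). \<lambda>w\<in>lists A. f (take n w) @ map \<tau> (drop n w)"
  have "finite ?W"
    using finite_lists_length_le[OF assms, of n] by (simp add: lists_eq_set)
  moreover have "Bij A \<subseteq> (\<Pi>\<^sub>E _\<in>A. A)"
    by (auto simp: Bij_def PiE_def bij_betw_def)
  then have "finite (Bij A)"
    using assms by (meson finite_PiE finite_subset)
  moreover have "eventually_letterwise A n \<subseteq> ?\<Phi> ` ((\<Pi>\<^sub>E _\<in>?W. ?W) \<times> Bij A)"
  proof
    fix g assume "g \<in> eventually_letterwise A n"
    then obtain \<tau> where g: "g \<in> Bij (lists A)" "\<And>w. w \<in> lists A \<Longrightarrow> length (g w) = length w"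
        and \<tau>: "\<tau> \<in> Bij A" "\<And>w. w \<in> lists A \<Longrightarrow> g w = g (take n w) @ map \<tau> (drop n w)"
      unfolding eventually_letterwise_def by blast
    let ?f = "restrict g ?W"
    have "g w = ?\<Phi> (?f, \<tau>) w" for w
    proof (cases "w \<in> lists A")
      case True
      then have "?\<Phi> (?f, \<tau>) w = g (take n w) @ map \<tau> (drop n w)"
        using take_in_lists[OF True, of n] by simp
      then show ?thesis using \<tau>(2)[OF True] by metis
    next
      case False
      \<comment> \<open>Both sides are \<open>undefined\<close> off \<open>lists A\<close>, as
        elements of \<open>Bij\<close> are extensional.\<close>
      then show ?thesis
        using extensional_arb[OF Bij_imp_extensional[OF g(1)] False] by simp
    qed
    then have "g = ?\<Phi> (?f, \<tau>)" by (rule ext)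
    moreover have "g w \<in> ?W" if "w \<in> ?W" for w
      using that g(2) funcset_mem[OF Bij_imp_funcset[OF g(1)], of w] by simp
    then have "?f \<in> (\<Pi>\<^sub>E _\<in>?W. ?W)" by (simp only: restrict_PiE_iff) blast
    ultimately show "g \<in> ?\<Phi> ` ((\<Pi>\<^sub>E _\<in>?W. ?W) \<times> Bij A)"
      using \<tau>(1) by (intro image_eqI[of _ _ "(?f, \<tau>)"]) auto
  qed
  ultimately show ?thesis
    by (meson finite_PiE finite_SigmaI finite_imageI finite_subset)
qed

text \<open>Because length is preserved, the cut at \<open>n\<close> is the same before and after
  applying an element; so the permutations acting on the tails compose and invert.\<close>

lemma subgroup_eventually_letterwise:
  "subgroup (eventually_letterwise A n) (BijGroup (lists A))"
proof (rule group.subgroupI[OF group_BijGroup])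
  show "eventually_letterwise A n \<subseteq> carrier (BijGroup (lists A))"
    by (auto simp: eventually_letterwise_def BijGroup_simps(1))
  have "(\<lambda>w\<in>lists A. w) \<in> eventually_letterwise A n"
    unfolding eventually_letterwise_def
  proof (intro CollectI conjI bexI ballI)
    fix w assume w: "w \<in> lists A"
    have "map (\<lambda>a\<in>A. a) (drop n w) = drop n w"
      using drop_in_lists[OF w] by (intro map_idI) auto
    then show "(\<lambda>w\<in>lists A. w) w = (\<lambda>w\<in>lists A. w) (take n w) @ map (\<lambda>a\<in>A. a) (drop n w)"
      using w take_in_lists[OF w] by simp
  qed (simp_all add: id_Bij)
  then show "eventually_letterwise A n \<noteq> {}" by blast
next
  fix g assume "g \<in> eventually_letterwise A n"
  then obtain \<tau> where g: "g \<in> Bij (lists A)" "\<And>w. w \<in> lists A \<Longrightarrow> length (g w) = length w"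
      and \<tau>: "\<tau> \<in> Bij A" "\<And>w. w \<in> lists A \<Longrightarrow> g w = g (take n w) @ map \<tau> (drop n w)"
    unfolding eventually_letterwise_def by blast
  let ?h = "\<lambda>w\<in>lists A. inv_into (lists A) g w"
  let ?\<sigma> = "\<lambda>a\<in>A. inv_into A \<tau> a"
  have bij: "bij_betw g (lists A) (lists A)" "bij_betw \<tau> A A"
    using g(1) \<tau>(1) by (auto simp: Bij_def)
  have h: "?h w \<in> lists A" "g (?h w) = w" if "w \<in> lists A" for w
    using that bij(1) bij_betw_inv_into_right[OF bij(1)] Bij_inv_into_mem[OF g(1)] by simp_all
  have len: "length (?h w) = length w" if "w \<in> lists A" for w
    using g(2)[OF h(1)[OF that]] h(2)[OF that] by simp
  have "?h w = ?h (take n w) @ map ?\<sigma> (drop n w)" if w: "w \<in> lists A" for w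
  proof -
    \<comment> \<open>\<open>?v\<close> is the expected preimage of \<open>w\<close>: the goal
      follows from \<open>g ?v = w = g (?h w)\<close> by injectivity of \<open>g\<close>.\<close>
    let ?v = "?h (take n w) @ map ?\<sigma> (drop n w)"
    note t = take_in_lists[OF w, of n] and d = drop_in_lists[OF w, of n]
    have \<sigma>: "?\<sigma> a \<in> A" "\<tau> (?\<sigma> a) = a" if "a \<in> A" for a
      using that bij_betw_inv_into_right[OF bij(2)] Bij_inv_into_mem[OF \<tau>(1)] by simp_all
    have v: "?v \<in> lists A" using h(1)[OF t] \<sigma>(1) d by (auto simp del: restrict_apply)
    \<comment> \<open>If \<open>w\<close> is shorter than \<open>n\<close> the tail is empty;
      otherwise \<open>?h (take n w)\<close> has length exactly \<open>n\<close>.\<close>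
    have "take n ?v = ?h (take n w)" "drop n ?v = map ?\<sigma> (drop n w)"
      using len[OF t] by (cases "n \<le> length w"; simp del: restrict_apply)+
    then have "g ?v = g (?h (take n w)) @ map \<tau> (map ?\<sigma> (drop n w))"
      using \<tau>(2)[OF v] by metis
    also have "map \<tau> (map ?\<sigma> (drop n w)) = drop n w"
      unfolding map_map using d \<sigma>(2) by (intro map_idI) (auto simp del: restrict_apply)
    finally have "g ?v = g (?h w)" using h(2)[OF t] h(2)[OF w] by (simp del: restrict_apply)
    then show ?thesis
      using bij(1) v h(1)[OF w] unfolding bij_betw_def by (metis inj_onD)
  qed
  then show "inv\<^bsub>BijGroup (lists A)\<^esub> g \<in> eventually_letterwise A n"
    unfolding inv_BijGroup[OF g(1)] eventually_letterwise_def
    using len restrict_inv_into_Bij[OF g(1)] restrict_inv_into_Bij[OF \<tau>(1)] by blast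
next
  fix f g assume "f \<in> eventually_letterwise A n" "g \<in> eventually_letterwise A n"
  then obtain \<sigma> \<tau> where
        f: "f \<in> Bij (lists A)" "\<And>w. w \<in> lists A \<Longrightarrow> length (f w) = length w"
    and \<sigma>: "\<sigma> \<in> Bij A" "\<And>w. w \<in> lists A \<Longrightarrow> f w = f (take n w) @ map \<sigma> (drop n w)"
    and g: "g \<in> Bij (lists A)" "\<And>w. w \<in> lists A \<Longrightarrow> length (g w) = length w"
    and \<tau>: "\<tau> \<in> Bij A" "\<And>w. w \<in> lists A \<Longrightarrow> g w = g (take n w) @ map \<tau> (drop n w)"
    unfolding eventually_letterwise_def by blast
  have gA: "g w \<in> lists A" if "w \<in> lists A" for w
    using Bij_imp_funcset[OF g(1)] that by blast
  have "f (g w) = f (g (take n w)) @ map (compose A \<sigma> \<tau>) (drop n w)" if w: "w \<in> lists A" for w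
  proof -
    have "take n (g w) = g (take n w)" "drop n (g w) = map \<tau> (drop n w)"
      unfolding \<tau>(2)[OF w] using g(2)[OF take_in_lists[OF w], of n]
      by (cases "n \<le> length w"; simp)+
    then have "f (g w) = f (g (take n w)) @ map \<sigma> (map \<tau> (drop n w))"
      using \<sigma>(2)[OF gA[OF w]] by metis
    also have "map \<sigma> (map \<tau> (drop n w)) = map (compose A \<sigma> \<tau>) (drop n w)"
      using drop_in_lists[OF w, of n] by (auto simp: compose_def)
    finally show ?thesis .
  qed
  then have "\<forall>w\<in>lists A. compose (lists A) f g w =
      compose (lists A) f g (take n w) @ map (compose A \<sigma> \<tau>) (drop n w)"
    using take_in_lists by (metis compose_eq)
  moreover have "\<forall>w\<in>lists A. length (compose (lists A) f g w) = length w"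
    using f(2) g(2) gA by (simp add: compose_eq del: in_lists_conv_set)
  ultimately have "compose (lists A) f g \<in> eventually_letterwise A n"
    unfolding eventually_letterwise_def
    using compose_Bij[OF f(1) g(1)] compose_Bij[OF \<sigma>(1) \<tau>(1)] by blast
  then show "f \<otimes>\<^bsub>BijGroup (lists A)\<^esub> g \<in> eventually_letterwise A n"
    using f(1) g(1) by (simp only: BijGroup_simps(3))
qed

text \<open>After \<open>n\<close> letters every run sits in \<open>s\<close>, so each generator is
  eventually letterwise with tail permutation given by the colors at \<open>s\<close>. The generated
  group then lies in a finite subgroup.\<close>

lemma nilpotent_imp_finite:
  assumes "dfa \<A>" "sink \<A> s" "nilpotent \<A>" "group_coloring \<A> \<chi>"
  shows "finite (carrier (automaton_group (mealy_of \<A> \<chi>)))"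
proof -
  let ?A = "alphabet \<A>" and ?M = "mealy_of \<A> \<chi>"
  obtain n where n: "\<And>q w. \<lbrakk>q \<in> states \<A>; w \<in> lists ?A; n \<le> length w\<rbrakk> \<Longrightarrow> run \<A> q w = s"
    using nilpotent_sink[OF assms(3,2)] by blast
  have s: "s \<in> states \<A>" "\<And>a. a \<in> ?A \<Longrightarrow> step \<A> s a = s"
    using assms(2) by (auto simp: sink_def)
  let ?\<tau> = "\<lambda>a\<in>?A. \<chi> (s, a)"
  have \<tau>: "?\<tau> \<in> Bij ?A"
    using group_coloring_bij[OF assms(4) s(1)] by (auto simp: Bij_def cong: bij_betw_cong)
  have "restrict (mealy_map ?M q) (lists ?A) \<in> eventually_letterwise ?A n"
    if q: "q \<in> states \<A>" for q
  proof -
    let ?g = "restrict (mealy_map ?M q) (lists ?A)"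
    have "mealy_map ?M q w = mealy_map ?M q (take n w) @ map ?\<tau> (drop n w)"
      if w: "w \<in> lists ?A" for w
    proof (cases "n \<le> length w")
      case True
      note t = take_in_lists[OF w, of n] and d = drop_in_lists[OF w, of n]
      have "foldl (step ?M) q (take n w) = s"
        using n[OF q t] True by (simp add: run_def)
      then have "mealy_map ?M q (take n w @ drop n w) =
          mealy_map ?M q (take n w) @ mealy_map ?M s (drop n w)"
        by (simp only: mealy_map_append)
      also have "mealy_map ?M s (drop n w) = map ?\<tau> (drop n w)"
        using mealy_map_sink[of ?A ?M s] s(2) d by auto
      finally show ?thesis by simp
    qed simp
    then have "\<forall>w\<in>lists ?A. ?g w = ?g (take n w) @ map ?\<tau> (drop n w)"
      using take_in_lists by (metis restrict_apply')
    moreover have "?g \<in> Bij (lists ?A)"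
      using mealy_map_bij[OF assms(1,4) q] by (auto simp: Bij_def cong: bij_betw_cong)
    moreover have "\<forall>w\<in>lists ?A. length (?g w) = length w" by simp
    ultimately show ?thesis
      unfolding eventually_letterwise_def using \<tau> by blast
  qed
  then have "carrier (automaton_group ?M) \<subseteq> eventually_letterwise ?A n"
    unfolding automaton_group_mealy_of[OF assms(1,4)]
    by (intro group.generate_subgroup_incl[OF group_BijGroup _ subgroup_eventually_letterwise]) auto
  then show ?thesis
    using finite_eventually_letterwise[of ?A n] assms(1) finite_subset by (auto simp: dfa_def)
qed

section \<open>The odometer coloring\<close>

lemma mealy_map_identity:
  assumes "w \<in> lists A" "q \<in> R"
    and "\<And>r a. \<lbrakk>r \<in> R; a \<in> A\<rbrakk> \<Longrightarrow> step M r a \<in> R \<and> out M r a = a"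
  shows "mealy_map M q w = w"
  using assms(1,2) by (induction w arbitrary: q rule: list.induct) (use assms(3) in auto)

text \<open>Used to carry triviality of a power from a state to its successors.\<close>

lemma mealy_map_funpow_fixed:
  assumes "out M q c = c"
  shows "(mealy_map M q ^^ n) (c # w) = c # (mealy_map M (step M q c) ^^ n) w"
  by (induction n) (use assms in auto)

text \<open>The odometer recursion: two applications turn \<open>a\<close> into \<open>b\<close> and
  back. The tail is acted on first by the state after \<open>a\<close>, then by the state after
  \<open>b\<close>, which does nothing.\<close>

lemma mealy_map_funpow_swap:
  assumes "out M p a = b" "out M p b = a" "w \<in> lists A"
    and "\<And>v. v \<in> lists A \<Longrightarrow> mealy_map M (step M p a) v \<in> lists A"
    and "\<And>v. v \<in> lists A \<Longrightarrow> mealy_map M (step M p b) v = v"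
  shows "(mealy_map M p ^^ (2 * n)) (a # w) = a # (mealy_map M (step M p a) ^^ n) w"
proof (induction n)
  case (Suc n)
  let ?g = "mealy_map M (step M p a)"
  \<comment> \<open>The state after \<open>b\<close> is known to act trivially only on words over
    \<open>A\<close>, so the iterates must stay there.\<close>
  have "(?g ^^ n) w \<in> lists A" for n
    by (induction n) (use assms(3,4) in auto)
  then have "?g ((?g ^^ n) w) \<in> lists A" using assms(4) by blast
  then show ?case using Suc assms(1,2,5) by (simp del: in_lists_conv_set)
qed simp

text \<open>Strong induction on the exponent, testing the power on words that start with
  \<open>a\<close>. The word \<open>u\<close> brings triviality from the state after
  \<open>a\<close> back to \<open>p\<close>.\<close>

lemma mealy_map_odometer:
  assumes ab: "a \<in> alphabet M" "b \<in> alphabet M" "a \<noteq> b"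
    and out: "out M p a = b" "out M p b = a"
      "\<And>r c. r \<noteq> p \<Longrightarrow> out M r c = c"
    and b: "\<And>v. v \<in> lists (alphabet M) \<Longrightarrow> mealy_map M (step M p b) v = v"
    and cl: "\<And>v. v \<in> lists (alphabet M) \<Longrightarrow> mealy_map M (step M p a) v \<in> lists (alphabet M)"
    and u: "u \<in> lists (alphabet M)" "foldl (step M) (step M p a) u = p"
    and triv: "\<And>w. w \<in> lists (alphabet M) \<Longrightarrow> (mealy_map M p ^^ n) w = w"
  shows "n = 0"
proof -
  let ?triv = "\<lambda>r n. \<forall>w\<in>lists (alphabet M). (mealy_map M r ^^ n) w = w"
  \<comment> \<open>States other than \<open>p\<close> copy their letter, so a trivial power stays
    trivial after each step of \<open>u\<close>. If \<open>p\<close> is met before the end, the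
    claim already holds there.\<close>
  have along: "?triv p n" if "u \<in> lists (alphabet M)" "?triv r n" "foldl (step M) r u = p" for n r u
    using that
  proof (induction u arbitrary: r rule: list.induct)
    case (Cons c u)
    show ?case
    proof (cases "r = p")
      case False
      have "?triv (step M r c) n"
      proof
        fix w assume "w \<in> lists (alphabet M)"
        then have "(mealy_map M r ^^ n) (c # w) = c # w" using Cons.prems by auto
        then show "(mealy_map M (step M r c) ^^ n) w = w"
          using mealy_map_funpow_fixed[of M r c n w] out(3)[OF False] by simp
      qed
      then show ?thesis using Cons.IH[of "step M r c"] Cons.prems by simp
    qed (use Cons.prems in simp)
  qed simp
  note swap = mealy_map_funpow_swap[OF out(1,2) _ cl b]
  have "?triv p n \<Longrightarrow> n = 0" for n
  proof (induction n rule: less_induct)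
    case (less n)
    have a: "(mealy_map M p ^^ n) (a # w) = a # w" if "w \<in> lists (alphabet M)" for w
      using less.prems that ab(1) by simp
    show ?case
    proof (cases "even n")
      case True
      then obtain m where m: "n = 2 * m" by blast
      have "?triv (step M p a) m" using a swap m by fastforce
      then have "?triv p m" using along u by blast
      \<comment> \<open>The induction hypothesis needs \<open>m < n\<close>, which fails only for
        \<open>m = 0\<close>, where \<open>n = 0\<close> anyway.\<close>
      then show ?thesis using less.IH[of m] m by (cases "m = 0") auto
    next
      case False
      then obtain m where m: "n = Suc (2 * m)" by (auto elim: oddE)
      \<comment> \<open>On the word \<open>[a]\<close> the first \<open>2 * m\<close> applications
        cancel and the last one yields \<open>[b]\<close>.\<close>
      have "(mealy_map M (step M p a) ^^ m) [] = []" by (induction m) auto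
      then have "(mealy_map M p ^^ n) [a] = [b]" using swap[of "[]" m] m out(1) by simp
      then show ?thesis using a[of "[]"] ab(3) by simp
    qed
  qed
  then show ?thesis using triv by blast
qed

text \<open>The exponent is the order of the generator at \<open>p\<close>. The work lies in
  identifying group powers of the restricted map with plain iterates on words.\<close>

lemma finite_group_power_trivial:
  assumes "dfa \<A>" "group_coloring \<A> \<chi>" "p \<in> states \<A>"
    and "finite (carrier (automaton_group (mealy_of \<A> \<chi>)))"
  obtains n where "n > 0"
    "\<And>w. w \<in> lists (alphabet \<A>) \<Longrightarrow> (mealy_map (mealy_of \<A> \<chi>) p ^^ n) w = w"
proof -
  let ?L = "lists (alphabet \<A>)" and ?f = "mealy_map (mealy_of \<A> \<chi>) p"
  let ?B = "BijGroup ?L" and ?G = "automaton_group (mealy_of \<A> \<chi>)"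
  define x where "x = restrict ?f ?L"
  interpret B: group ?B by (rule group_BijGroup)
  interpret G: group ?G unfolding automaton_group_def by simp
  have f: "bij_betw ?f ?L ?L" by (rule mealy_map_bij[OF assms(1-3)])
  then have xB: "x \<in> Bij ?L" by (auto simp: x_def Bij_def cong: bij_betw_cong)
  have xG: "x \<in> carrier ?G"
    unfolding automaton_group_mealy_of[OF assms(1,2)] x_def
    using assms(3) by (intro generate.incl) auto
  have pow: "x [^]\<^bsub>?G\<^esub> n = x [^]\<^bsub>?B\<^esub> n" for n :: nat
    by (simp add: automaton_group_def pow_subgroup_generated)
  have powB: "x [^]\<^bsub>?B\<^esub> n \<in> Bij ?L" for n :: nat
    using B.nat_pow_closed[of x n] xB by (simp only: BijGroup_simps(1))
  have apply_pow: "(x [^]\<^bsub>?B\<^esub> n) w = (?f ^^ n) w" if "w \<in> ?L" for n w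
    using that
  proof (induction n arbitrary: w)
    case 0
    then show ?case by (simp add: BijGroup_simps(2))
  next
    case (Suc n)
    have "?f w \<in> ?L" using f Suc.prems by (rule bij_betwE[THEN bspec])
    \<comment> \<open>The group power adds the new factor on the right, so it is applied first;
      hence \<open>w\<close> is arbitrary in the induction.\<close>
    moreover have "(x [^]\<^bsub>?B\<^esub> Suc n) w = (x [^]\<^bsub>?B\<^esub> n) (?f w)"
    proof -
      have "x [^]\<^bsub>?B\<^esub> Suc n = compose ?L (x [^]\<^bsub>?B\<^esub> n) x"
        using powB[of n] xB by (simp only: B.nat_pow_Suc BijGroup_simps(3))
      then show ?thesis using Suc.prems by (simp add: compose_eq x_def)
    qed
    ultimately show ?case using Suc.IH by (simp add: funpow_swap1)
  qed
  obtain n :: nat where "n > 0" "x [^]\<^bsub>?G\<^esub> n = \<one>\<^bsub>?G\<^esub>"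
  proof
    \<comment> \<open>Finiteness enters here: an element of infinite order would have
      \<open>ord\<close> equal to \<open>0\<close>.\<close>
    show "G.ord x > 0" using G.ord_ge_1[OF assms(4) xG] by linarith
    show "x [^]\<^bsub>?G\<^esub> G.ord x = \<one>\<^bsub>?G\<^esub>" by (rule G.pow_ord_eq_1[OF xG])
  qed
  moreover have "(x [^]\<^bsub>?G\<^esub> n) w = w" if "w \<in> ?L" "x [^]\<^bsub>?G\<^esub> n = \<one>\<^bsub>?G\<^esub>" for w
    using that by (simp add: automaton_group_def BijGroup_simps(2))
  ultimately show ?thesis using that apply_pow pow by metis
qed

lemma infinite_automaton_group:
  assumes "dfa \<A>" "p \<in> states \<A>" "a \<in> alphabet \<A>" "b \<in> alphabet \<A>"
    "reaches \<A> (step \<A> p a) p" "\<not> reaches \<A> (step \<A> p b) p"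
  obtains \<chi> where "group_coloring \<A> \<chi>" "infinite (carrier (automaton_group (mealy_of \<A> \<chi>)))"
proof -
  let ?A = "alphabet \<A>"
  define \<chi> where "\<chi> = (\<lambda>(q, c). if q = p then transpose a b c else c)"
  let ?M = "mealy_of \<A> \<chi>"
  have "bij_betw \<chi> ({q} \<times> ?A) ?A" for q
  \<comment> \<open>At each state the coloring is an involution, so it serves as its own
    inverse.\<close>
  proof (rule bij_betw_byWitness[where f' = "\<lambda>c. (q, \<chi> (q, c))"])
  qed (use assms(3,4) in \<open>auto simp: \<chi>_def transpose_def\<close>)
  then have col: "group_coloring \<A> \<chi>" by (simp add: group_coloring_def)
  have "infinite (carrier (automaton_group ?M))"
  proof
    assume "finite (carrier (automaton_group ?M))"
    then obtain n where n: "n > 0" "\<And>w. w \<in> lists ?A \<Longrightarrow> (mealy_map ?M p ^^ n) w = w"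
      using finite_group_power_trivial[OF assms(1) col assms(2)] by blast
    obtain u where u: "u \<in> lists ?A" "run \<A> (step \<A> p a) u = p"
      using assms(5) by (auto simp: reaches_def)
    have "mealy_map ?M (step \<A> p b) v = v" if "v \<in> lists ?A" for v
    \<comment> \<open>The states that cannot reach \<open>p\<close> are closed under steps and
      exclude \<open>p\<close> itself, so all of them copy their letters.\<close>
    proof (rule mealy_map_identity[where R = "{r. \<not> reaches \<A> r p}", OF that])
      show "step ?M r c \<in> {r. \<not> reaches \<A> r p} \<and> out ?M r c = c"
        if "r \<in> {r. \<not> reaches \<A> r p}" "c \<in> ?A" for r c
        using that reaches_trans[OF reaches_step[OF that(2)]] by (auto simp: \<chi>_def)
    qed (use assms(6) in simp)
    moreover have "mealy_map ?M (step \<A> p a) v \<in> lists ?A" if "v \<in> lists ?A" for v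
    proof -
      have "step \<A> p a \<in> states \<A>" using assms(1-3) by (auto simp: dfa_def)
      then show ?thesis
        using mealy_map_bij[OF assms(1) col] that by (meson bij_betwE)
    qed
    \<comment> \<open>Only one of the two successors of \<open>p\<close> can reach
      \<open>p\<close>.\<close>
    moreover have "a \<noteq> b" using assms(5,6) by auto
    ultimately have "n = 0"
      using assms(3,4) u n(2)
      by (intro mealy_map_odometer[of a ?M b p u]) (auto simp: \<chi>_def run_def)
    then show False using n(1) by simp
  qed
  then show ?thesis using that col by blast
qed

theorem theorem4:
  fixes \<A> :: "('q, 'a) automaton" and s :: 'q
  assumes "dfa \<A>" and "synchronizing \<A>" and "sink \<A> s" and "card (alphabet \<A>) > 1"
  shows "(\<forall>G\<in>GC \<A>. finite (carrier G)) \<longleftrightarrow> nilpotent \<A>"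
proof
  assume fin: "\<forall>G\<in>GC \<A>. finite (carrier G)"
  show "nilpotent \<A>"
  proof (rule ccontr)
    assume "\<not> nilpotent \<A>"
    then obtain p a b where "p \<in> states \<A>" "a \<in> alphabet \<A>" "b \<in> alphabet \<A>"
        "reaches \<A> (step \<A> p a) p" "\<not> reaches \<A> (step \<A> p b) p"
      using not_nilpotent_exit[OF assms(1-3)] by blast
    then obtain \<chi> where "group_coloring \<A> \<chi>" "infinite (carrier (automaton_group (mealy_of \<A> \<chi>)))"
      using infinite_automaton_group[OF assms(1)] by blast
    then show False using fin by (auto simp: GC_def)
  qed
next
  assume "nilpotent \<A>"
  then show "\<forall>G\<in>GC \<A>. finite (carrier G)"
    using nilpotent_imp_finite[OF assms(1,3)] by (auto simp: GC_def)
qed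

end
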